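(* Let $n$ be a positive integer, let $\mathbb{F}$ be a field, and let $\mathcal{V}\subseteq\mathbb{F}^n$ be a non-empty finite subset of the affine space $\mathbb{F}^n$. Suppose that there exists a finite subgroup $G\leq\mathrm{Aff}(\mathbb{F},n)$ such that $G$ is a transitive subgroup of the symmetric group $\mathrm{Sym}(\mathcal{V})$. Then $$\frac{n\cdot|\mathcal{V}|^{\frac1n}}{e}-n<ac(\mathcal{V}).$$
   Context: Here $e$ is the base of the natural logarithm. $\mathrm{Aff}(\mathbb{F},n)$ is the group of affine isomorphisms of $\mathbb{F}^n$, and $\mathrm{Sym}(\mathcal{V})$ is the group of all permutations of $\mathcal{V}$. That $G$ is a transitive subgroup of $\mathrm{Sym}(\mathcal{V})$ means that every $g\in G$ maps $\mathcal{V}$ onto itself and that $G$, regarded via restriction to $\mathcal{V}$ as a group of permutations of $\mathcal{V}$, acts transitively on $\mathcal{V}$. For a finite set of points $\mathcal{V}\subseteq\mathbb{F}^n$ and $\mathbf{v}\in\mathcal{V}$, a finite (possibly empty) set of affine hyperplanes $\{H_1,\ldots,H_m\}$ of $\mathbb{F}^n$ is an almost cover of $\mathcal{V}$ and $\mathbf{v}$ if the union $\bigcup_{j=1}^m H_j$ contains $\mathcal{V}\setminus\{\mathbf{v}\}$ but does not contain $\mathbf{v}$. $AC(\mathcal{V},\mathbf{v})$ denotes the minimum size (number of hyperplanes) of an almost cover of $\mathcal{V}$ and $\mathbf{v}$, and $ac(\mathcal{V}):=\min_{\mathbf{v}\in\mathcal{V}}AC(\mathcal{V},\mathbf{v})$.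 *)

theory Defs
  imports "HOL-Analysis.Analysis" "HOL-Algebra.Group_Action"
begin

definition Aff :: "(('a::field ^ 'n) \<Rightarrow> ('a ^ 'n)) monoid" where
  "Aff = \<lparr>carrier = {f. \<exists>A b. invertible A \<and> f = (\<lambda>x. A *v x + b)},
          mult = (\<circ>), one = id\<rparr>"

lemma Aff_group: "group (Aff :: (('a::field ^ 'n) \<Rightarrow> ('a ^ 'n)) monoid)"
proof (rule groupI)
  fix f g :: "'a ^ 'n \<Rightarrow> 'a ^ 'n"
  assume "f \<in> carrier Aff" "g \<in> carrier Aff"
  then obtain A b B c where
    "invertible A" "f = (\<lambda>x. A *v x + b)" "invertible B" "g = (\<lambda>x. B *v x + c)"
    unfolding Aff_def by auto
  then have "invertible (A ** B)" "f \<circ> g = (\<lambda>x. (A ** B) *v x + (A *v c + b))"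
    by (auto simp: invertible_mult fun_eq_iff matrix_vector_mul_assoc
        matrix_vector_right_distrib add.assoc)
  then show "f \<otimes>\<^bsub>Aff\<^esub> g \<in> carrier Aff"
    unfolding Aff_def by auto
next
  have "id = (\<lambda>x::'a ^ 'n. mat 1 *v x + 0)" by auto
  moreover have "invertible (mat 1 :: 'a ^ 'n ^ 'n)"
    unfolding invertible_def by (metis matrix_mul_lid)
  ultimately have "\<exists>A b. invertible A \<and> (id :: 'a ^ 'n \<Rightarrow> 'a ^ 'n) = (\<lambda>x. A *v x + b)"
    by blast
  then show "\<one>\<^bsub>Aff\<^esub> \<in> carrier (Aff :: (('a ^ 'n) \<Rightarrow> ('a ^ 'n)) monoid)"
    unfolding Aff_def by simp
next
  fix f :: "'a ^ 'n \<Rightarrow> 'a ^ 'n"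
  assume "f \<in> carrier Aff"
  then obtain A b where A: "invertible A" and f: "f = (\<lambda>x. A *v x + b)"
    unfolding Aff_def by auto
  then obtain B where B: "A ** B = mat 1" "B ** A = mat 1"
    unfolding invertible_def by auto
  let ?g = "\<lambda>x. B *v x + - (B *v b)"
  have "invertible B"
    using B unfolding invertible_def by blast
  then have "\<exists>C c. invertible C \<and> ?g = (\<lambda>x. C *v x + c)"
    by blast
  then have "?g \<in> carrier Aff"
    unfolding Aff_def by simp
  moreover have "?g \<circ> f = id"
    using B by (auto simp: f fun_eq_iff matrix_vector_right_distrib matrix_vector_mul_assoc)
  ultimately show "\<exists>g\<in>carrier Aff. g \<otimes>\<^bsub>Aff\<^esub> f = \<one>\<^bsub>Aff\<^esub>"
    unfolding Aff_def by auto
qed (auto simp: Aff_def comp_assoc)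

text \<open>The elements of \<^term>\<open>BijGroup V\<close> are extensional functions, so the action is by
  restriction to \<open>V\<close>; it is not required to be faithful.\<close>

definition transitive_on :: "(('a::field ^ 'n) \<Rightarrow> ('a ^ 'n)) set \<Rightarrow> ('a ^ 'n) set \<Rightarrow> bool" where
  "transitive_on G V \<longleftrightarrow> transitive_action (Aff\<lparr>carrier := G\<rparr>) V (\<lambda>g. restrict g V)"

lemma transitive_on_iff:
  fixes G :: "(('a::field ^ 'n) \<Rightarrow> ('a ^ 'n)) set"
  assumes "subgroup G Aff"
  shows "transitive_on G V \<longleftrightarrow> (\<forall>g\<in>G. g ` V = V) \<and> (\<forall>x\<in>V. \<forall>y\<in>V. \<exists>g\<in>G. g x = y)"
proof
  assume "transitive_on G V"
  then interpret transitive_action "Aff\<lparr>carrier := G\<rparr>" V "\<lambda>g. restrict g V"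
    unfolding transitive_on_def .
  show "(\<forall>g\<in>G. g ` V = V) \<and> (\<forall>x\<in>V. \<forall>y\<in>V. \<exists>g\<in>G. g x = y)"
    using surj_prop unique_orbit by (fastforce simp: image_restrict_eq)
next
  assume R: "(\<forall>g\<in>G. g ` V = V) \<and> (\<forall>x\<in>V. \<forall>y\<in>V. \<exists>g\<in>G. g x = y)"
  have inj: "inj g" if "g \<in> G" for g
  proof -
    have "inv\<^bsub>Aff\<^esub> g \<circ> g = id"
      using group.l_inv[OF Aff_group, of g] subgroup.mem_carrier[OF assms that]
      by (simp add: Aff_def)
    then show ?thesis by (metis inj_on_id inj_on_imageI2)
  qed
  have B: "restrict g V \<in> Bij V" if "g \<in> G" for g
    using R that inj_on_subset[OF inj[OF that] subset_UNIV]
    by (simp add: Bij_def bij_betw_def inj_on_restrict_eq)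
  have "restrict (g \<circ> h) V = compose V (restrict g V) (restrict h V)" if "h \<in> G" for g h :: "'a ^ 'n \<Rightarrow> 'a ^ 'n"
  proof
    fix x
    show "restrict (g \<circ> h) V x = compose V (restrict g V) (restrict h V) x"
      using R that by (cases "x \<in> V") (auto simp: compose_def)
  qed
  then have "group_hom (Aff\<lparr>carrier := G\<rparr>) (BijGroup V) (\<lambda>g. restrict g V)"
    using B subgroup.subgroup_is_group[OF assms Aff_group]
    by (simp add: group_hom_def group_hom_axioms_def group_BijGroup hom_def)
       (simp add: BijGroup_def Aff_def Pi_def)
  then show "transitive_on G V"
    using R unfolding transitive_on_def
    by (simp add: transitive_action_def group_action_def transitive_action_axioms_def)
qed

definition affine_hyperplane :: "('a::field ^ 'n) set \<Rightarrow> bool" where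
  "affine_hyperplane H \<longleftrightarrow> (\<exists>a b. a \<noteq> 0 \<and> H = {x. (\<Sum>i\<in>UNIV. a $ i * x $ i) = b})"

definition almost_cover :: "('a::field ^ 'n) set \<Rightarrow> ('a ^ 'n) \<Rightarrow> ('a ^ 'n) set set \<Rightarrow> bool" where
  "almost_cover V v \<H> \<longleftrightarrow>
     finite \<H> \<and> (\<forall>H\<in>\<H>. affine_hyperplane H) \<and> V - {v} \<subseteq> \<Union>\<H> \<and> v \<notin> \<Union>\<H>"

definition AC :: "('a::field ^ 'n) set \<Rightarrow> ('a ^ 'n) \<Rightarrow> nat" where
  "AC V v = (LEAST k. \<exists>\<H>. almost_cover V v \<H> \<and> card \<H> = k)"

text \<open>For finite \<open>V\<close> the minimum is over a non-empty set.\<close>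

lemma almost_cover_exists:
  fixes V :: "('a::field ^ 'n) set"
  assumes "finite V"
  shows "\<exists>\<H>. almost_cover V v \<H>"
proof -
  have "\<exists>H. affine_hyperplane H \<and> w \<in> H \<and> v \<notin> H" if neq: "w \<noteq> v" for w
  proof -
    obtain i where i: "w $ i \<noteq> v $ i"
      using neq by (auto simp: vec_eq_iff)
    have ax: "(\<Sum>j\<in>UNIV. axis i 1 $ j * x $ j) = x $ i" for x :: "'a ^ 'n"
      by (simp add: axis_def if_distrib[where f = "\<lambda>c. c * _"] cong: if_cong)
    have "affine_hyperplane {x. (\<Sum>j\<in>UNIV. axis i 1 $ j * x $ j) = w $ i}"
      unfolding affine_hyperplane_def
      by (intro exI[of _ "axis i 1"] exI[of _ "w $ i"]) (auto simp: axis_eq_0_iff)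
    then show ?thesis
      using i by (intro exI[of _ "{x. (\<Sum>j\<in>UNIV. axis i 1 $ j * x $ j) = w $ i}"]) (auto simp: ax)
  qed
  then obtain h where "\<And>w. w \<noteq> v \<Longrightarrow> affine_hyperplane (h w) \<and> w \<in> h w \<and> v \<notin> h w"
    by metis
  then show ?thesis
    using assms by (intro exI[of _ "h ` (V - {v})"]) (auto simp: almost_cover_def)
qed

definition ac :: "('a::field ^ 'n) set \<Rightarrow> nat" where
  "ac V = Min (AC V ` V)"

end

theory Submission
  imports Defs "HOL-Library.Function_Algebras"
begin

text \<open>An almost cover by \<open>k\<close> hyperplanes gives a product of \<open>k\<close> affine functions that is nonzero
  at \<open>v\<close> and vanishes on the rest of \<open>V\<close>. Composing it with elements of \<open>G\<close> yields such a polynomial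
  of degree at most \<open>k\<close> for every point of \<open>V\<close>. These are linearly independent, so \<open>|V|\<close> is at
  most the dimension \<open>(n + k) choose n \<le> (n + k)^n / n!\<close>, and \<open>n! > (n / e)^n\<close>.\<close>

interpretation fun_space: vector_space "\<lambda>(c::'a::field) (f::'b \<Rightarrow> 'a) x. c * f x"
  by unfold_locales (auto simp: fun_eq_iff algebra_simps)

text \<open>The coordinate \<open>None\<close> is the homogenizing one, so that monomials of degree at most \<open>k\<close>
  correspond to multisets of size exactly \<open>k\<close>.\<close>

definition coord :: "'n option \<Rightarrow> ('a::field ^ 'n) \<Rightarrow> 'a" where
  "coord i x = (case i of None \<Rightarrow> 1 | Some j \<Rightarrow> x $ j)"

definition monomial :: "'n option multiset \<Rightarrow> ('a::field ^ 'n) \<Rightarrow> 'a" where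
  "monomial M x = (\<Prod>i\<in>#M. coord i x)"

text \<open>Functions, not formal polynomials: over a finite field distinct monomials may agree as
  functions. Only an upper bound on the dimension is wanted, so such coincidences are
  harmless.\<close>

definition polys :: "nat \<Rightarrow> (('a::field ^ 'n) \<Rightarrow> 'a) set" where
  "polys k = fun_space.span (monomial ` multisets_of_size UNIV k)"

text \<open>The linear part \<open>a\<close> may vanish, so constants count as affine and composing
  with an affine map is a mere computation with coefficients.\<close>

definition affine_function :: "(('a::field ^ 'n) \<Rightarrow> 'a) \<Rightarrow> bool" where
  "affine_function l \<longleftrightarrow> (\<exists>a b. l = (\<lambda>x. (\<Sum>i\<in>UNIV. a $ i * x $ i) + b))"

lemma polys_add: "f \<in> polys k \<Longrightarrow> g \<in> polys k \<Longrightarrow> (\<lambda>x. f x + g x) \<in> polys k"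
  using fun_space.span_add[of f _ g] by (simp add: polys_def plus_fun_def)

lemma polys_scale: "f \<in> polys k \<Longrightarrow> (\<lambda>x. c * f x) \<in> polys k"
  using fun_space.span_scale[of f _ c] by (simp add: polys_def)

lemma polys_sum:
  assumes "finite I" "\<And>i. i \<in> I \<Longrightarrow> f i \<in> polys k"
  shows "(\<lambda>x. \<Sum>i\<in>I. f i x) \<in> polys k"
  using assms
proof (induction I rule: finite_induct)
  case empty
  show ?case
    using fun_space.span_zero by (simp add: polys_def zero_fun_def)
next
  case (insert i I)
  then show ?case
    using polys_add[of "f i" k "\<lambda>x. \<Sum>i\<in>I. f i x"] by simp
qed

text \<open>On a monomial, multiplication by \<open>coord i\<close> just adds \<open>i\<close> to
  the multiset; the functions \<open>f\<close> satisfying the claim form a subspace, so it extends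
  to the span.\<close>

lemma polys_mult_coord:
  fixes f :: "'a::field ^ 'n \<Rightarrow> 'a"
  assumes "f \<in> polys k"
  shows "(\<lambda>x. coord i x * f x) \<in> polys (Suc k)"
proof -
  let ?S = "{f :: 'a ^ 'n \<Rightarrow> 'a. (\<lambda>x. coord i x * f x) \<in> polys (Suc k)}"
  have "fun_space.span (monomial ` multisets_of_size UNIV k) \<subseteq> ?S"
  proof (rule fun_space.span_minimal)
    show "monomial ` multisets_of_size UNIV k \<subseteq> ?S"
    proof (rule image_subsetI)
      fix M :: "'n option multiset"
      assume "M \<in> multisets_of_size UNIV k"
      then have "monomial (add_mset i M) \<in> (polys (Suc k) :: ('a ^ 'n \<Rightarrow> 'a) set)"
        by (auto simp: polys_def multisets_of_size_def intro!: fun_space.span_base)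
      then show "monomial M \<in> ?S"
        by (simp add: monomial_def[abs_def])
    qed
    show "fun_space.subspace ?S"
    proof (rule fun_space.subspaceI)
      show "0 \<in> ?S"
        using fun_space.span_zero by (simp add: polys_def zero_fun_def)
    next
      fix f g assume "f \<in> ?S" "g \<in> ?S"
      then show "f + g \<in> ?S"
        using polys_add[of "\<lambda>x. coord i x * f x" "Suc k" "\<lambda>x. coord i x * g x"]
        by (simp add: distrib_left)
    next
      fix c f assume "f \<in> ?S"
      then show "(\<lambda>x. c * f x) \<in> ?S"
        using polys_scale[of "\<lambda>x. coord i x * f x" "Suc k" c]
        by (simp add: mult.left_commute)
    qed
  qed
  then show ?thesis
    using assms by (auto simp: polys_def[of k])
qed

lemma polys_mult_affine:
  assumes "affine_function l" "f \<in> polys k"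
  shows "(\<lambda>x. l x * f x) \<in> polys (Suc k)"
proof -
  obtain a b where l: "l = (\<lambda>x. (\<Sum>i\<in>UNIV. a $ i * x $ i) + b)"
    using assms(1) by (auto simp: affine_function_def)
  \<comment> \<open>Writing the constant term as \<open>b * coord None x\<close> homogenizes
    \<open>l\<close>: every summand is now a scalar times a coordinate times
    \<open>f\<close>.\<close>
  have "(\<lambda>x. l x * f x) =
    (\<lambda>x. (\<Sum>i\<in>UNIV. a $ i * (coord (Some i) x * f x)) + b * (coord None x * f x))"
    by (simp add: l coord_def distrib_right sum_distrib_right mult.assoc)
  then show ?thesis
    using assms(2) by (simp add: polys_add polys_sum polys_scale polys_mult_coord)
qed

lemma polys_prod_affine:
  assumes "finite I" "\<And>i. i \<in> I \<Longrightarrow> affine_function (l i)"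
  shows "(\<lambda>x. \<Prod>i\<in>I. l i x) \<in> polys (card I)"
  using assms
proof (induction I rule: finite_induct)
  case empty
  have "monomial {#} \<in> polys 0"
    by (auto simp: polys_def intro: fun_space.span_base)
  then show ?case
    by (simp add: monomial_def[abs_def])
next
  case (insert i I)
  then show ?case
    using polys_mult_affine[of "l i" "\<lambda>x. \<Prod>i\<in>I. l i x"] by simp
qed

lemma affine_function_comp_Aff:
  assumes "affine_function l" "g \<in> carrier Aff"
  shows "affine_function (\<lambda>x. l (g x))"
proof -
  obtain a b where l: "l = (\<lambda>x. (\<Sum>i\<in>UNIV. a $ i * x $ i) + b)"
    using assms(1) by (auto simp: affine_function_def)
  obtain A c where g: "g = (\<lambda>x. A *v x + c)"
    using assms(2) by (auto simp: Aff_def)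
  \<comment> \<open>The matrix moves from the argument to the coefficient vector by exchanging the
    two sums.\<close>
  have "(\<Sum>i\<in>UNIV. a $ i * (A *v x) $ i) = (\<Sum>j\<in>UNIV. (a v* A) $ j * x $ j)" for x
    unfolding matrix_vector_mult_def vector_matrix_mult_def
    by (simp add: sum_distrib_left sum_distrib_right mult_ac) (rule sum.swap)
  then have "(\<lambda>x. l (g x)) =
      (\<lambda>x. (\<Sum>j\<in>UNIV. (a v* A) $ j * x $ j) + ((\<Sum>i\<in>UNIV. a $ i * c $ i) + b))"
    by (simp add: l g distrib_left sum.distrib add.assoc)
  then show ?thesis
    unfolding affine_function_def by blast
qed

lemma affine_hyperplane_affine_function:
  assumes "affine_hyperplane H"
  obtains l where "affine_function l" "\<And>x. l x = 0 \<longleftrightarrow> x \<in> H"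
proof -
  obtain a b where H: "H = {x. (\<Sum>i\<in>UNIV. a $ i * x $ i) = b}"
    using assms by (auto simp: affine_hyperplane_def)
  show ?thesis
  proof (rule that)
    show "affine_function (\<lambda>x. (\<Sum>i\<in>UNIV. a $ i * x $ i) + (- b))"
      unfolding affine_function_def by blast
  qed (simp add: H)
qed

text \<open>Evaluation at \<open>w\<close> kills every \<open>p u\<close> with
  \<open>u \<noteq> w\<close>, hence their span, but not \<open>p w\<close>. So the
  \<open>p w\<close> are independent, and there are at most as many of them as there are spanning
  monomials.\<close>

lemma card_le_choose_of_separating_polys:
  fixes V :: "('a::field ^ 'n) set"
  assumes "finite V"
    and poly: "\<And>w. w \<in> V \<Longrightarrow> p w \<in> polys k"
    and nz: "\<And>w. w \<in> V \<Longrightarrow> p w w \<noteq> 0"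
    and z: "\<And>u w. u \<in> V \<Longrightarrow> w \<in> V \<Longrightarrow> u \<noteq> w \<Longrightarrow> p w u = 0"
  shows "card V \<le> (CARD('n) + k) choose CARD('n)"
proof -
  have inj: "inj_on p V"
    by (rule inj_onI) (metis nz z)
  have "fun_space.independent (p ` V)"
  proof
    assume "fun_space.dependent (p ` V)"
    then obtain w where w: "w \<in> V" "p w \<in> fun_space.span (p ` V - {p w})"
      by (auto simp: fun_space.dependent_def)
    have "fun_space.span (p ` V - {p w}) \<subseteq> {f. f w = 0}"
    proof (rule fun_space.span_minimal)
      show "p ` V - {p w} \<subseteq> {f. f w = 0}"
        using z w(1) by auto
      show "fun_space.subspace {f. f w = 0}"
        by (auto intro: fun_space.subspaceI)
    qed
    then show False
      using w nz by auto
  qed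
  moreover have "p ` V \<subseteq> fun_space.span (monomial ` multisets_of_size UNIV k)"
    using poly by (auto simp: polys_def)
  moreover have fin: "finite (multisets_of_size (UNIV :: 'n option set) k)"
    by (simp add: finite_multisets_of_size)
  ultimately have "card (p ` V) \<le> card (monomial ` multisets_of_size (UNIV :: 'n option set) k
      :: ('a ^ 'n \<Rightarrow> 'a) set)"
    using fun_space.independent_span_bound by blast
  also have "\<dots> \<le> card (multisets_of_size (UNIV :: 'n option set) k)"
    using fin by (rule card_image_le)
  \<comment> \<open>Stars and bars: multisets of size \<open>k\<close> over the
    \<open>CARD('n) + 1\<close> elements of \<open>'n option\<close>.\<close>
  also have "\<dots> = (CARD('n) + k) choose k"
    by (simp add: card_multisets_of_size)
  also have "\<dots> = (CARD('n) + k) choose CARD('n)"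
    using binomial_symmetric[of k "CARD('n) + k"] by simp
  finally show ?thesis
    by (simp add: card_image[OF inj])
qed

text \<open>For each \<open>w\<close> choose \<open>g w\<close> in \<open>G\<close> carrying
  \<open>w\<close> to \<open>v\<close>. The product of the equations of the hyperplanes, pulled back
  along \<open>g w\<close>, is nonzero at \<open>w\<close> and vanishes on the rest of
  \<open>V\<close>.\<close>

lemma card_le_choose_of_almost_cover:
  fixes V :: "('a::field ^ 'n) set"
  assumes "finite V" "v \<in> V" "almost_cover V v \<H>"
    and "subgroup G Aff" "transitive_on G V"
  shows "card V \<le> (CARD('n) + card \<H>) choose CARD('n)"
proof -
  have cover: "finite \<H>" "\<forall>H\<in>\<H>. affine_hyperplane H" "V - {v} \<subseteq> \<Union>\<H>" "v \<notin> \<Union>\<H>"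
    using assms(3) by (auto simp: almost_cover_def)
  have "\<exists>l. affine_function l \<and> (\<forall>x. l x = 0 \<longleftrightarrow> x \<in> H)" if "H \<in> \<H>" for H
  proof -
    have "affine_hyperplane H"
      using cover(2) that by simp
    then show ?thesis
      by (rule affine_hyperplane_affine_function) auto
  qed
  then obtain l where l: "\<And>H. H \<in> \<H> \<Longrightarrow> affine_function (l H)"
      "\<And>H x. H \<in> \<H> \<Longrightarrow> l H x = 0 \<longleftrightarrow> x \<in> H"
    by metis
  have G: "\<And>g. g \<in> G \<Longrightarrow> g ` V = V" "\<And>x y. x \<in> V \<Longrightarrow> y \<in> V \<Longrightarrow> \<exists>g\<in>G. g x = y"
    using assms(5) transitive_on_iff[OF assms(4)] by auto
  have "\<forall>w\<in>V. \<exists>g\<in>G. g w = v"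
    using G(2) assms(2) by blast
  then obtain g where g: "\<And>w. w \<in> V \<Longrightarrow> g w \<in> G" "\<And>w. w \<in> V \<Longrightarrow> g w w = v"
    by metis
  show ?thesis
  proof (rule card_le_choose_of_separating_polys[OF assms(1)])
    fix w assume "w \<in> V"
    have "g w \<in> carrier Aff"
      using g(1)[OF \<open>w \<in> V\<close>] subgroup.mem_carrier[OF assms(4)] by blast
    show "(\<lambda>x. \<Prod>H\<in>\<H>. l H (g w x)) \<in> polys (card \<H>)"
      by (rule polys_prod_affine[OF cover(1) affine_function_comp_Aff[OF l(1) \<open>g w \<in> carrier Aff\<close>]])
    show "(\<Prod>H\<in>\<H>. l H (g w w)) \<noteq> 0"
      using cover g(2)[OF \<open>w \<in> V\<close>] l(2) by auto
  next
    fix u w assume uw: "u \<in> V" "w \<in> V" "u \<noteq> w"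
    \<comment> \<open>A map of the finite set \<open>V\<close> onto itself is injective on it, so
      \<open>w\<close> is the only point of \<open>V\<close> sent to \<open>v\<close>.\<close>
    have "inj_on (g w) V"
      using assms(1) G(1)[OF g(1)[OF uw(2)]] by (simp add: eq_card_imp_inj_on)
    then have "g w u \<noteq> v"
      using uw g(2) by (metis inj_onD)
    then have "g w u \<in> \<Union>\<H>"
      using cover(3) G(1)[OF g(1)[OF uw(2)]] uw(1) by blast
    then show "(\<Prod>H\<in>\<H>. l H (g w u)) = 0"
      using cover(1) l(2) by auto
  qed
qed

lemma power_self_less_exp_mult_fact:
  assumes "n > 0"
  shows "real n ^ n < exp (real n) * fact n"
proof -
  \<comment> \<open>Two terms of the exponential series at \<open>n\<close>. Keeping the term 1 of
    index 0, distinct from index \<open>n\<close> as \<open>n > 0\<close>, makes the final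
    inequality strict.\<close>
  have "1 + real n ^ n / fact n = (\<Sum>i\<in>{0, n}. real n ^ i /\<^sub>R fact i)"
    using assms by (simp add: divide_inverse)
  also have "\<dots> \<le> exp (real n)"
    unfolding exp_def by (rule sum_le_suminf) (auto simp: summable_exp)
  finally have "real n ^ n / fact n < exp (real n)"
    by simp
  then show ?thesis
    by (simp add: divide_less_eq)
qed

lemma choose_less_exp_power:
  assumes "n > 0"
  shows "real ((n + k) choose n) < (exp 1 * (real n + real k) / real n) ^ n"
proof -
  \<comment> \<open>The left side is a falling factorial: \<open>n\<close> factors, each at most
    \<open>n + k\<close>.\<close>
  have "real ((n + k) choose n) * fact n \<le> (real n + real k) ^ n"
    using of_nat_mono[OF binomial_fact_pow[of "n + k" n], where 'a = real] by simp
  then have "real ((n + k) choose n) \<le> (real n + real k) ^ n / fact n"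
    by (simp add: field_simps)
  also have "\<dots> = (real n + real k) ^ n * (1 / fact n)"
    by simp
  also have "\<dots> < (real n + real k) ^ n * (exp (real n) / real n ^ n)"
  proof (rule mult_strict_left_mono)
    show "1 / fact n < exp (real n) / real n ^ n"
      using power_self_less_exp_mult_fact[OF assms] assms by (simp add: divide_simps)
  qed (use assms in simp)
  also have "\<dots> = (exp 1 * (real n + real k) / real n) ^ n"
    by (simp add: power_divide power_mult_distrib exp_of_nat_mult[symmetric])
  finally show ?thesis .
qed

theorem corollary1p11:
  fixes V :: "('a::field ^ 'n) set" and G :: "(('a ^ 'n) \<Rightarrow> ('a ^ 'n)) set"
  assumes "finite V" and "V \<noteq> {}"
    and "subgroup G Aff" and "finite G" and "transitive_on G V"
  shows "real CARD('n) * real (card V) powr (1 / real CARD('n)) / exp 1 - real CARD('n)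
         < real (ac V)"
proof -
  let ?n = "CARD('n)" and ?k = "ac V"
  have "?k \<in> AC V ` V"
    using assms(1,2) unfolding ac_def by (intro Min_in) auto
  then obtain v where v: "v \<in> V" "?k = AC V v"
    by auto
  \<comment> \<open>The \<open>LEAST\<close> in \<open>AC\<close> is attained because some almost
    cover exists.\<close>
  have "\<exists>\<H>. almost_cover V v \<H> \<and> card \<H> = AC V v"
    unfolding AC_def
    by (rule LeastI_ex[where P = "\<lambda>k. \<exists>\<H>. almost_cover V v \<H> \<and> card \<H> = k"])
      (use almost_cover_exists[OF assms(1), of v] in simp)
  then obtain \<H> where "almost_cover V v \<H>" "card \<H> = ?k"
    using v(2) by auto
  then have "card V \<le> (?n + ?k) choose ?n"
    using card_le_choose_of_almost_cover[OF assms(1) v(1) _ assms(3,5)] by metis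
  then have "real (card V) \<le> real ((?n + ?k) choose ?n)"
    by (rule of_nat_mono)
  also have "\<dots> < (exp 1 * (real ?n + real ?k) / real ?n) ^ ?n"
    by (rule choose_less_exp_power) simp
  \<comment> \<open>The base is positive, so the power can be read as \<open>powr\<close>; taking
    \<open>n\<close>-th roots is strictly monotone and isolates \<open>ac V\<close>.\<close>
  finally have "real (card V) < (exp 1 * (real ?n + real ?k) / real ?n) powr real ?n"
    by (simp add: powr_realpow add_pos_nonneg)
  then have "real (card V) powr (1 / real ?n) <
      ((exp 1 * (real ?n + real ?k) / real ?n) powr real ?n) powr (1 / real ?n)"
    by (intro powr_less_mono2) auto
  also have "\<dots> = exp 1 * (real ?n + real ?k) / real ?n"
    by (simp add: powr_powr)
  finally show ?thesis
    by (simp add: field_simps)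
qed

end
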